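(* Let $D=\{z\in\mathbb{C}:|z|<1\}$ and let $f:D\to\mathbb{C}$ be a bounded analytic function. Then there exist $N_0\in\mathbb{N}$ and a sequence of $C$-polynomials $P_N(z)$, $N\ge N_0$ (depending only on $f$), such that $\deg P_N=N$ for every $N\ge N_0$ and the following holds: for every $a$ with $0<a<1$ and every $\varepsilon\in(0,1-a)$, $$\left|\frac{P_N'(z)}{P_N(z)}-f(z)\right|<\frac{(a+\varepsilon)^{n+1}}{\varepsilon(1-a-\varepsilon)}\,(1+o(1)),\qquad n=[N/2],\qquad \text{as } N\to\infty,$$ for all $z$ in the disk $K_a=\{z\in\mathbb{C}:|z|\le a\}$. Here $o(1)$ denotes a real sequence $\delta_N$, $N\ge N_0$, which may depend on $f$, $a$ and $\varepsilon$ but not on $z\in K_a$, with $\delta_N\to 0$ as $N\to\infty$.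
   Context: A $C$-polynomial is a polynomial with complex coefficients all of whose zeros lie on the unit circle $C=\{z\in\mathbb{C}:|z|=1\}$. $[x]$ denotes the integer part (floor) of $x$. *)

theory Defs
  imports
    "HOL-Complex_Analysis.Complex_Analysis"
    "HOL-Computational_Algebra.Polynomial"
begin

(* The zero polynomial is excluded automatically, since it vanishes at 0;
   nonzero constants qualify vacuously. *)
definition C_polynomial :: "complex poly \<Rightarrow> bool" where
  "C_polynomial p \<longleftrightarrow> (\<forall>z. poly p z = 0 \<longrightarrow> z \<in> sphere 0 1)"

end

theory Submission
  imports Defs
begin

text \<open>
  Since the logarithmic derivative of a function determines it up to a constant factor, it is
  natural to approximate \<open>F = exp g\<close>, where \<open>g\<close> is the primitive of \<open>f\<close> with \<open>g 0 = 0\<close>: then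
  \<open>F' / F = f\<close>. Boundedness of \<open>f\<close> by \<open>M\<close> makes \<open>\<bar>F\<bar>\<close> lie between \<open>exp (- M)\<close> and \<open>exp M\<close>,
  and makes \<open>F' = f F\<close> bounded as well.

  Write \<open>F = \<Sum>k. c k * z ^ k\<close>, and let \<open>S\<close> be the Taylor polynomial of \<open>F\<close> of order
  \<open>n = N div 2\<close>. Bessel's inequality for the bounded function \<open>F'\<close> gives a finite sum
  of \<open>k\<^sup>2 * \<bar>c k\<bar>\<^sup>2\<close>, hence \<open>\<Sum>k. \<bar>c k\<bar> < \<infinity>\<close> (\<open>summable_norm_coeffs_of_bounded_deriv\<close>).
  Therefore \<open>S\<close> tends to \<open>F\<close> uniformly on the whole open disk, and for large \<open>N\<close> it has no zero
  in the closed disk (\<open>truncation_bounded_below\<close>).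

  The polynomial \<open>P z = S z + z ^ N * cnj (S (1 / cnj z))\<close> then has all its zeros on the unit
  circle: on the circle the two summands have equal modulus, so by the maximum principle the first
  one dominates inside, while \<open>P z = z ^ N * cnj (P (1 / cnj z))\<close> transfers nonvanishing
  from the inside to the outside (\<open>C_polynomial_self_inversive\<close>). The second summand starts with
  a power of \<open>z\<close> that is at least \<open>n\<close>, and so does the Taylor remainder of \<open>F\<close>; hence
  \<open>P - F = O (r ^ n)\<close> on the disk of radius \<open>r < 1\<close>. Cauchy's inequality turns this into
  \<open>P' / P - f = O (r ^ n)\<close> on a smaller disk (\<open>log_derivative_error\<close>).

  With \<open>r = a + \<epsilon> / 2\<close> this error is of smaller order than \<open>(a + \<epsilon>) ^ (n + 1)\<close>, so that it can be
  absorbed in the factor \<open>1 + o(1)\<close> whatever the constants in it are.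
\<close>

section \<open>Absolute convergence of Taylor series with bounded derivative\<close>

text \<open>
  Orthogonality of the characters of the cyclic group of order \<open>L\<close>. Averaging over roots of unity
  in place of integrating over the circle keeps the proof of Bessel's inequality finite.
\<close>
lemma discrete_parseval:
  fixes b :: "nat \<Rightarrow> complex"
  assumes "L > 0"
  shows "(\<Sum>j<L. (norm (\<Sum>k<L. b k * cis (2 * pi * real j / real L) ^ k))\<^sup>2)
           = real L * (\<Sum>k<L. (norm (b k))\<^sup>2)"
proof -
  define \<omega> where "\<omega> j = cis (2 * pi * real j / real L)" for j
  have bij: "bij_betw \<omega> {..<L} {z. z ^ L = 1}"
    unfolding \<omega>_def by (rule Complex.bij_betw_roots_unity[OF assms])
  have swap: "\<omega> j ^ k = \<omega> k ^ j" for j k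
    by (simp add: \<omega>_def Complex.DeMoivre mult_ac)
  have orth: "(\<Sum>j<L. \<omega> j ^ k * cnj (\<omega> j ^ l)) = (if k = l then of_nat L else 0)"
    if "k < L" "l < L" for k l
  proof -
    define x where "x = \<omega> k * cnj (\<omega> l)"
    have unit: "\<omega> i * cnj (\<omega> i) = 1" "cnj (\<omega> i) * \<omega> i = 1" for i
      by (simp_all add: \<omega>_def cis_cnj cis_mult)
    have "x = 1 \<longleftrightarrow> k = l"
    proof
      assume "x = 1"
      then have "\<omega> k = \<omega> l"
        using unit[of l] by (metis mult.assoc mult_1_left mult_1_right x_def)
      then show "k = l"
        using bij that by (auto simp: bij_betw_def inj_on_def)
    qed (use unit x_def in auto)
    moreover have "x ^ L = 1"
    proof -
      have "\<omega> k ^ L = 1" "\<omega> l ^ L = 1"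
        using bij that by (auto simp: bij_betw_def)
      then show ?thesis
        by (simp add: x_def power_mult_distrib flip: complex_cnj_power)
    qed
    moreover have "(\<Sum>j<L. \<omega> j ^ k * cnj (\<omega> j ^ l)) = (\<Sum>j<L. x ^ j)"
      by (simp only: swap[of _ k] swap[of _ l]) (simp add: x_def power_mult_distrib)
    ultimately show ?thesis
      by (cases "k = l") (simp_all add: geometric_sum)
  qed
  have "complex_of_real (\<Sum>j<L. (norm (\<Sum>k<L. b k * \<omega> j ^ k))\<^sup>2)
      = (\<Sum>j<L. \<Sum>k<L. \<Sum>l<L. b k * cnj (b l) * (\<omega> j ^ k * cnj (\<omega> j ^ l)))"
    unfolding of_real_sum complex_norm_square cnj_sum sum_product
    by (simp add: mult_ac)
  also have "\<dots> = (\<Sum>k<L. \<Sum>l<L. \<Sum>j<L. b k * cnj (b l) * (\<omega> j ^ k * cnj (\<omega> j ^ l)))"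
    by (subst sum.swap, rule sum.cong[OF refl], rule sum.swap)
  also have "\<dots> = (\<Sum>k<L. \<Sum>l<L. b k * cnj (b l) * (if k = l then of_nat L else 0))"
    by (intro sum.cong refl) (subst sum_distrib_left[symmetric], subst orth, auto)
  also have "\<dots> = complex_of_real (real L * (\<Sum>k<L. (norm (b k))\<^sup>2))"
    by (simp add: if_distrib sum.delta sum_distrib_left mult_ac cong: if_cong
        flip: complex_norm_square)
  finally show ?thesis
    unfolding of_real_eq_iff \<omega>_def .
qed

lemma sum_norm_coeffs_squared_le:
  fixes b :: "nat \<Rightarrow> complex"
  assumes "\<And>z. norm z = 1 \<Longrightarrow> norm (\<Sum>k<L. b k * z ^ k) \<le> B" and "L > 0"
  shows "(\<Sum>k<L. (norm (b k))\<^sup>2) \<le> B\<^sup>2"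
proof -
  have "real L * (\<Sum>k<L. (norm (b k))\<^sup>2) \<le> (\<Sum>j<L. B\<^sup>2)"
    unfolding discrete_parseval[OF \<open>L > 0\<close>, symmetric]
    by (intro sum_mono power_mono assms) auto
  with \<open>L > 0\<close> show ?thesis by simp
qed

text \<open>
  On the circle of radius \<open>r < 1\<close> the partial sums of the series are bounded by \<open>M\<close> plus a
  remainder \<open>t L\<close> that vanishes in the limit; apply the inequality for polynomials to these, then
  let \<open>L\<close> tend to infinity and \<open>r\<close> to 1.
\<close>
lemma bessel_power_series:
  fixes b :: "nat \<Rightarrow> complex"
  assumes sums: "\<And>z. norm z < 1 \<Longrightarrow> (\<lambda>k. b k * z ^ k) sums g z"
    and bound: "\<And>z. norm z < 1 \<Longrightarrow> norm (g z) \<le> M"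
  shows "(\<Sum>k<m. (norm (b k))\<^sup>2) \<le> M\<^sup>2"
proof -
  have radius: "(\<Sum>k<m. (norm (b k) * r ^ k)\<^sup>2) \<le> M\<^sup>2" if r: "0 < r" "r < 1" for r :: real
  proof -
    define t where "t L = (\<Sum>k. norm (b (k + L)) * r ^ (k + L))" for L
    have "summable (\<lambda>k. norm (b k * of_real r ^ k))"
      by (rule powser_insidea[OF sums_summable[OF sums[of "of_real ((r + 1) / 2)"]]])
         (use r in \<open>simp_all del: of_real_divide of_real_add\<close>)
    then have summ: "summable (\<lambda>k. norm (b k) * r ^ k)"
      using r by (simp add: norm_mult norm_power)
    then have t_lim: "t \<longlonglongrightarrow> 0"
      unfolding t_def by (rule suminf_exist_split2)
    have partial: "norm (\<Sum>k<L. b k * of_real r ^ k * z ^ k) \<le> M + t L" if "norm z = 1" for z L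
    proof -
      define w where "w = of_real r * z"
      have w: "norm w = r"
        using that r by (simp add: w_def norm_mult)
      have "(\<lambda>k. b (k + L) * w ^ (k + L)) sums (g w - (\<Sum>k<L. b k * w ^ k))"
        using sums_split_initial_segment[OF sums[of w], of L] w r by simp
      then have "norm (g w - (\<Sum>k<L. b k * w ^ k)) \<le> t L"
        unfolding t_def
        by (rule norm_sums_le[OF _ summable_sums])
           (use summable_ignore_initial_segment[OF summ, of L] w in \<open>simp_all add: norm_mult norm_power\<close>)
      moreover have "norm (g w) \<le> M"
        using bound w r by simp
      moreover have "(\<Sum>k<L. b k * of_real r ^ k * z ^ k) = (\<Sum>k<L. b k * w ^ k)"
        by (simp add: w_def power_mult_distrib mult_ac)
      ultimately show ?thesis
        using norm_triangle_sub[of "\<Sum>k<L. b k * w ^ k" "g w"] by (simp add: norm_minus_commute)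
    qed
    have "(\<Sum>k<m. (norm (b k) * r ^ k)\<^sup>2) \<le> (M + t L)\<^sup>2" if "L \<ge> m" "L > 0" for L
    proof -
      have "(\<Sum>k<m. (norm (b k) * r ^ k)\<^sup>2) \<le> (\<Sum>k<L. (norm (b k) * r ^ k)\<^sup>2)"
        using that by (intro sum_mono2) auto
      also have "\<dots> \<le> (M + t L)\<^sup>2"
        using sum_norm_coeffs_squared_le[OF partial \<open>L > 0\<close>] r
        by (simp add: norm_mult norm_power)
      finally show ?thesis .
    qed
    moreover have "(\<lambda>L. (M + t L)\<^sup>2) \<longlonglongrightarrow> (M + 0)\<^sup>2"
      by (intro tendsto_intros t_lim)
    ultimately show ?thesis
      by (intro tendsto_lowerbound[of "\<lambda>L. (M + t L)\<^sup>2" "M\<^sup>2" sequentially])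
         (auto intro!: exI[of _ "Suc m"] simp: eventually_sequentially)
  qed
  have "((\<lambda>r. \<Sum>k<m. (norm (b k) * r ^ k)\<^sup>2) \<longlongrightarrow> (\<Sum>k<m. (norm (b k) * 1 ^ k)\<^sup>2)) (at_left (1::real))"
    by (intro tendsto_intros)
  moreover have "eventually (\<lambda>r. (\<Sum>k<m. (norm (b k) * r ^ k)\<^sup>2) \<le> M\<^sup>2) (at_left (1::real))"
    using eventually_at_left_real[OF zero_less_one] by eventually_elim (use radius in auto)
  ultimately show ?thesis
    using tendsto_upperbound[of _ _ "at_left (1::real)"] by fastforce
qed

text \<open>
  Bessel's inequality for \<open>F'\<close> bounds the sum of \<open>k\<^sup>2 * \<bar>c k\<bar>\<^sup>2\<close>, and
  \<open>\<bar>c k\<bar> = (k * \<bar>c k\<bar>) * (1 / k) \<le> k\<^sup>2 * \<bar>c k\<bar>\<^sup>2 + 1 / k\<^sup>2\<close> reduces the claim to it.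
\<close>
lemma summable_norm_coeffs_of_bounded_deriv:
  fixes F :: "complex \<Rightarrow> complex"
  assumes hol: "F holomorphic_on ball 0 1"
    and bound: "\<And>z. norm z < 1 \<Longrightarrow> norm (deriv F z) \<le> M"
  shows "summable (\<lambda>k. norm ((deriv ^^ k) F 0 / fact k))"
proof -
  define c where "c k = (deriv ^^ k) F 0 / fact k" for k
  have "(\<lambda>k. of_nat (Suc k) * c (Suc k) * z ^ k) sums deriv F z" if "norm z < 1" for z
  proof -
    have "(\<lambda>k. (deriv ^^ k) (deriv F) 0 / fact k * (z - 0) ^ k) sums deriv F z"
      by (rule holomorphic_power_series[of _ _ 1]) (use hol that in \<open>auto intro: holomorphic_deriv\<close>)
    moreover have "(deriv ^^ k) (deriv F) 0 / fact k = of_nat (Suc k) * c (Suc k)" for k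
      by (simp add: c_def funpow_swap1 divide_simps del: of_nat_Suc)
    ultimately show ?thesis by simp
  qed
  from bessel_power_series[OF this bound]
  have "(\<Sum>k<m. (norm (of_nat (Suc k) * c (Suc k)))\<^sup>2) \<le> M\<^sup>2" for m
    by blast
  then have "summable (\<lambda>k. (norm (of_nat (Suc k) * c (Suc k)))\<^sup>2)"
    by (intro summableI_nonneg_bounded) auto
  moreover have "summable (\<lambda>k. inverse (real (Suc k) ^ 2))"
    using inverse_power_summable[of 2, where 'a = real] by (subst summable_Suc_iff) auto
  ultimately have dominating: "summable (\<lambda>k. (norm (of_nat (Suc k) * c (Suc k)))\<^sup>2 + inverse (real (Suc k) ^ 2))"
    by (rule summable_add)
  have "norm (c (Suc k)) \<le> (norm (of_nat (Suc k) * c (Suc k)))\<^sup>2 + inverse (real (Suc k) ^ 2)" for k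
  proof -
    define s where "s = real (Suc k)"
    have "s > 0" by (simp add: s_def)
    have "norm (c (Suc k)) = (s * norm (c (Suc k))) * inverse s"
      using \<open>s > 0\<close> by simp
    also have "\<dots> \<le> (s * norm (c (Suc k)))\<^sup>2 + (inverse s)\<^sup>2"
    proof -
      have "0 \<le> s * norm (c (Suc k)) * inverse s"
        using \<open>s > 0\<close> by simp
      then show ?thesis
        using sum_squares_bound[of "s * norm (c (Suc k))" "inverse s"] by linarith
    qed
    finally have "norm (c (Suc k)) \<le> (s * norm (c (Suc k)))\<^sup>2 + inverse (s ^ 2)"
      by (simp add: power_inverse)
    then show ?thesis
      by (simp add: s_def norm_mult del: of_nat_Suc)
  qed
  then have "summable (\<lambda>k. norm (c (Suc k)))"
    by (intro summable_comparison_test[OF _ dominating]) (simp del: of_nat_Suc)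
  then show ?thesis
    by (simp only: c_def summable_Suc_iff[where f = "\<lambda>k. norm ((deriv ^^ k) F 0 / fact k)"])
qed

section \<open>Self-inversive polynomials with zeros on the circle\<close>

definition conj_reflect_poly :: "complex poly \<Rightarrow> complex poly" where
  "conj_reflect_poly p = reflect_poly (map_poly cnj p)"

lemma poly_conj_reflect:
  assumes "z \<noteq> 0"
  shows "poly (conj_reflect_poly p) z = z ^ degree p * cnj (poly p (1 / cnj z))"
  using assms
  by (simp add: conj_reflect_poly_def poly_reflect_poly_nz degree_map_poly inverse_eq_divide)

lemma norm_conj_reflect_on_circle:
  assumes "norm z = 1"
  shows "norm (poly (conj_reflect_poly p) z) = norm (poly p z)"
proof -
  have "z * cnj z = 1"
    using assms by (simp flip: complex_norm_square)
  moreover from this have "z \<noteq> 0" by auto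
  ultimately have "z \<noteq> 0" "1 / cnj z = z"
    by (simp_all add: divide_eq_eq)
  then show ?thesis
    using assms by (simp add: poly_conj_reflect norm_mult norm_power)
qed

text \<open>
  The quotient of the two polynomials is holomorphic in the disk and unimodular on its boundary,
  so that the maximum principle applies.
\<close>
lemma norm_conj_reflect_le:
  assumes nz: "\<And>z. norm z \<le> 1 \<Longrightarrow> poly p z \<noteq> 0" and "norm z \<le> 1"
  shows "norm (poly (conj_reflect_poly p) z) \<le> norm (poly p z)"
proof -
  have "norm (poly (conj_reflect_poly p) z / poly p z) \<le> 1"
  proof (rule maximum_modulus_frontier
      [where S = "cball 0 1" and f = "\<lambda>z. poly (conj_reflect_poly p) z / poly p z"])
    show "(\<lambda>z. poly (conj_reflect_poly p) z / poly p z) holomorphic_on interior (cball 0 1)"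
      using nz by (auto intro!: holomorphic_intros)
    show "continuous_on (closure (cball 0 1)) (\<lambda>z. poly (conj_reflect_poly p) z / poly p z)"
      using nz by (auto intro!: continuous_intros)
    show "norm (poly (conj_reflect_poly p) w / poly p w) \<le> 1" if "w \<in> frontier (cball 0 1)" for w
      using that nz by (simp add: norm_divide norm_conj_reflect_on_circle)
  qed (use assms in auto)
  then show ?thesis
    using nz assms by (simp add: norm_divide)
qed

text \<open>
  This is \<open>p z + z ^ N * cnj (p (1 / cnj z))\<close> with \<open>N = m + degree p\<close>. The shift \<open>m\<close> is the parameter,
  rather than \<open>N\<close>, because it is the order of contact with \<open>p\<close> at 0.
\<close>
definition self_inversive_poly :: "nat \<Rightarrow> complex poly \<Rightarrow> complex poly" where
  "self_inversive_poly m p = p + monom 1 m * conj_reflect_poly p"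

lemma poly_self_inversive:
  "poly (self_inversive_poly m p) z = poly p z + z ^ m * poly (conj_reflect_poly p) z"
  by (simp add: self_inversive_poly_def poly_monom)

lemma norm_self_inversive_minus_le:
  assumes "\<And>z. norm z \<le> 1 \<Longrightarrow> poly p z \<noteq> 0" and "norm z \<le> 1"
  shows "norm (poly (self_inversive_poly m p) z - poly p z) \<le> norm z ^ m * norm (poly p z)"
  using norm_conj_reflect_le[OF assms]
  by (simp add: poly_self_inversive norm_mult norm_power mult_left_mono)

lemma degree_self_inversive:
  assumes "poly p 0 \<noteq> 0" "m > 0"
  shows "degree (self_inversive_poly m p) = m + degree p"
proof -
  have "coeff (map_poly cnj p) 0 \<noteq> 0"
    using assms by (simp add: coeff_map_poly poly_0_coeff_0)
  then have "degree (conj_reflect_poly p) = degree p" "conj_reflect_poly p \<noteq> 0"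
    by (auto simp: conj_reflect_poly_def degree_map_poly)
  then have "degree (monom 1 m * conj_reflect_poly p) = m + degree p"
    by (simp add: degree_mult_eq degree_monom_eq)
  with \<open>m > 0\<close> show ?thesis
    unfolding self_inversive_poly_def by (subst degree_add_eq_right) auto
qed

lemma self_inversive_nonzero_inside:
  assumes nz: "\<And>z. norm z \<le> 1 \<Longrightarrow> poly p z \<noteq> 0" and "m > 0" "norm z < 1"
  shows "poly (self_inversive_poly m p) z \<noteq> 0"
proof
  assume "poly (self_inversive_poly m p) z = 0"
  then have "norm (poly p z) \<le> norm z ^ m * norm (poly p z)"
    using norm_self_inversive_minus_le[OF nz, of z m] assms by simp
  moreover have "norm z ^ m < 1"
    using assms by (simp add: power_less_one_iff)
  ultimately show False
    using nz[of z] assms by (simp add: mult_le_cancel_right1)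
qed

text \<open>
  A zero outside the disk would be reflected by \<open>z \<mapsto> 1 / cnj z\<close> to a zero inside.
\<close>
lemma C_polynomial_self_inversive:
  assumes nz: "\<And>z. norm z \<le> 1 \<Longrightarrow> poly p z \<noteq> 0" and "m > 0"
  shows "C_polynomial (self_inversive_poly m p)"
  unfolding C_polynomial_def
proof (intro allI impI)
  fix z assume root: "poly (self_inversive_poly m p) z = 0"
  have "norm z \<ge> 1"
    using self_inversive_nonzero_inside[OF nz \<open>m > 0\<close>, of z] root by force
  moreover have False if "norm z > 1"
  proof -
    have z: "z \<noteq> 0" using that by auto
    define w where "w = 1 / cnj z"
    have w: "norm w < 1" "w \<noteq> 0" "1 / cnj w = z" "cnj w = 1 / z"
      using that z by (auto simp: w_def norm_divide)
    have "poly (self_inversive_poly m p) w = w ^ (m + degree p) * cnj (poly (self_inversive_poly m p) z)"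
      using z w by (simp add: poly_self_inversive poly_conj_reflect power_add)
        (simp add: w_def field_simps)
    with root have "poly (self_inversive_poly m p) w = 0" by simp
    with self_inversive_nonzero_inside[OF nz \<open>m > 0\<close> w(1)] show False by simp
  qed
  ultimately show "z \<in> sphere 0 1" by force
qed


section \<open>Truncating the exponential of a primitive\<close>

lemma exponential_of_primitive:
  fixes f :: "complex \<Rightarrow> complex"
  assumes hol: "f holomorphic_on ball 0 1" and bound: "\<And>z. norm z < 1 \<Longrightarrow> norm (f z) \<le> M"
  obtains F where "\<And>z. norm z < 1 \<Longrightarrow> (F has_field_derivative f z * F z) (at z)"
    and "\<And>z. norm z < 1 \<Longrightarrow> exp (- M) \<le> norm (F z)"
    and "\<And>z. norm z < 1 \<Longrightarrow> norm (F z) \<le> exp M"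
proof -
  obtain g where g: "\<And>z. z \<in> ball 0 1 \<Longrightarrow> (g has_field_derivative f z) (at z within ball 0 1)"
    using holomorphic_convex_primitive'[OF convex_ball open_ball hol] by blast
  define F where "F z = exp (g z - g 0)" for z
  have deriv: "(F has_field_derivative f z * F z) (at z)" if "norm z < 1" for z
  proof -
    have "(g has_field_derivative f z) (at z)"
      using g[of z] that by (simp add: at_within_open[of z "ball 0 1"])
    then show ?thesis
      unfolding F_def by (auto intro!: derivative_eq_intros)
  qed
  have Re_bound: "\<bar>Re (g z - g 0)\<bar> \<le> M" if "norm z < 1" for z
  proof -
    have "norm (g z - g 0) \<le> M * norm (z - 0)"
      by (rule field_differentiable_bound[OF convex_ball g]) (use bound that in auto)
    also have "\<dots> \<le> M"
      using that order.trans[OF norm_ge_zero bound[of 0]] mult_left_le[of "norm z" M] by simp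
    finally show ?thesis
      using abs_Re_le_cmod[of "g z - g 0"] by linarith
  qed
  show thesis
  proof (rule that[OF deriv])
    show "exp (- M) \<le> norm (F z)" "norm (F z) \<le> exp M" if "norm z < 1" for z
      using Re_bound[OF that] by (auto simp: F_def abs_le_iff)
  qed
qed

definition truncation :: "(nat \<Rightarrow> complex) \<Rightarrow> nat \<Rightarrow> complex poly" where
  "truncation c n = (\<Sum>k\<le>n. monom (c k) k)"

lemma poly_truncation: "poly (truncation c n) z = (\<Sum>k\<le>n. c k * z ^ k)"
  by (simp add: truncation_def poly_sum poly_monom)

lemma degree_truncation_le: "degree (truncation c n) \<le> n"
  unfolding truncation_def by (intro degree_sum_le) (auto intro: order.trans[OF degree_monom_le])

lemma norm_truncation_le:
  assumes "summable (\<lambda>k. norm (c k))" "norm z \<le> 1"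
  shows "norm (poly (truncation c n) z) \<le> (\<Sum>k. norm (c k))"
proof -
  have "norm (poly (truncation c n) z) \<le> (\<Sum>k\<le>n. norm (c k * z ^ k))"
    unfolding poly_truncation by (rule norm_sum)
  also have "\<dots> \<le> (\<Sum>k\<le>n. norm (c k))"
    using assms by (intro sum_mono) (auto simp: norm_mult norm_power intro!: mult_left_le power_le_one)
  also have "\<dots> \<le> (\<Sum>k. norm (c k))"
    using assms by (intro sum_le_suminf) auto
  finally show ?thesis .
qed

text \<open>
  The two factors serve two purposes: on a smaller disk the power of \<open>z\<close> gives geometric
  convergence, and on the whole disk the tail sum gives uniform convergence. The true exponent
  \<open>n + 1\<close> is lowered to \<open>n\<close>, the exponent that the reflected half of the approximant
  of degree \<open>2 * n\<close> permits.
\<close>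
lemma norm_minus_truncation_le:
  assumes summ: "summable (\<lambda>k. norm (c k))"
    and sums: "(\<lambda>k. c k * z ^ k) sums w" and z: "norm z \<le> 1"
  shows "norm (w - poly (truncation c n) z) \<le> norm z ^ n * (\<Sum>k. norm (c (k + Suc n)))"
proof (rule norm_sums_le)
  show "(\<lambda>k. c (k + Suc n) * z ^ (k + Suc n)) sums (w - poly (truncation c n) z)"
    using sums_split_initial_segment[OF sums, of "Suc n"]
    by (simp only: poly_truncation lessThan_Suc_atMost)
  show "(\<lambda>k. norm z ^ n * norm (c (k + Suc n))) sums (norm z ^ n * (\<Sum>k. norm (c (k + Suc n))))"
    using summable_ignore_initial_segment[OF summ, of "Suc n"] by (intro sums_mult summable_sums)
  show "norm (c (k + Suc n) * z ^ (k + Suc n)) \<le> norm z ^ n * norm (c (k + Suc n))" for k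
    using z power_decreasing[of n "k + Suc n" "norm z"]
    by (subst mult.commute) (auto simp: norm_mult norm_power simp del: power_Suc intro!: mult_right_mono)
qed

text \<open>
  The series is only known to represent \<open>F\<close> in the open disk; the bound reaches the circle because
  polynomials are continuous.
\<close>
lemma truncation_bounded_below:
  assumes summ: "summable (\<lambda>k. norm (c k))"
    and sums: "\<And>z. norm z < 1 \<Longrightarrow> (\<lambda>k. c k * z ^ k) sums F z"
    and lower: "\<And>z. norm z < 1 \<Longrightarrow> \<mu> \<le> norm (F z)" and "\<mu> > 0"
  obtains n0 where "\<And>n z. n \<ge> n0 \<Longrightarrow> norm z \<le> 1 \<Longrightarrow> \<mu> / 2 \<le> norm (poly (truncation c n) z)"
proof -
  obtain n0 where n0: "\<And>n. n \<ge> n0 \<Longrightarrow> norm (\<Sum>k. norm (c (k + n))) < \<mu> / 2"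
    using suminf_exist_split[of "\<mu> / 2", OF _ summ] \<open>\<mu> > 0\<close> by auto
  show thesis
  proof
    fix n and z :: complex assume n: "n \<ge> n0" and "norm z \<le> 1"
    have inside: "\<mu> / 2 \<le> norm (poly (truncation c n) w)" if "w \<in> ball 0 1" for w
    proof -
      have tail: "0 \<le> (\<Sum>k. norm (c (k + Suc n)))" "(\<Sum>k. norm (c (k + Suc n))) < \<mu> / 2"
        using n0[of "Suc n"] n summable_ignore_initial_segment[OF summ, of "Suc n"]
        by (auto intro!: suminf_nonneg)
      have "norm (F w - poly (truncation c n) w) \<le> norm w ^ n * (\<Sum>k. norm (c (k + Suc n)))"
        using that by (intro norm_minus_truncation_le summ sums) auto
      also have "\<dots> \<le> (\<Sum>k. norm (c (k + Suc n)))"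
        using that tail by (intro mult_left_le_one_le power_le_one) auto
      finally show ?thesis
        using tail lower[of w] that norm_triangle_ineq2[of "F w" "poly (truncation c n) w"]
          norm_triangle_sub[of "F w" "poly (truncation c n) w"] by simp
    qed
    have "closure (ball 0 1) \<subseteq> {w. \<mu> / 2 \<le> norm (poly (truncation c n) w)}"
      using inside by (intro closure_minimal closed_Collect_le continuous_intros) auto
    then show "\<mu> / 2 \<le> norm (poly (truncation c n) z)"
      using \<open>norm z \<le> 1\<close> by auto
  qed
qed

section \<open>Approximation of the logarithmic derivative\<close>

text \<open>
  For \<open>G = p - F\<close> one has \<open>p' / p - f = (G' - f * G) / p\<close>, because \<open>F' = f * F\<close>; Cauchy's
  inequality on disks of radius \<open>\<eta>\<close> controls \<open>G'\<close>.
\<close>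
lemma log_derivative_error:
  fixes p :: "complex poly"
  assumes deriv: "\<And>w. norm w < 1 \<Longrightarrow> (F has_field_derivative f w * F w) (at w)"
    and close: "\<And>w. norm w \<le> a + \<eta> \<Longrightarrow> norm (poly p w - F w) \<le> B"
    and "0 < \<eta>" "a + \<eta> < 1" "norm z \<le> a"
    and "norm (f z) \<le> M" "\<kappa> \<le> norm (poly p z)" "0 < \<kappa>"
  shows "norm (poly (pderiv p) z / poly p z - f z) \<le> (B / \<eta> + M * B) / \<kappa>"
proof -
  define G where "G w = poly p w - F w" for w
  have dG: "(G has_field_derivative (poly (pderiv p) w - f w * F w)) (at w)" if "norm w < 1" for w
    unfolding G_def by (intro DERIV_diff poly_DERIV deriv that)
  have near: "norm w \<le> a + \<eta>" if "w \<in> cball z \<eta>" for w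
    using that assms norm_triangle_sub[of w z] by (auto simp: dist_norm norm_minus_commute)
  have "norm ((deriv ^^ 1) G z) \<le> fact 1 * B / \<eta> ^ 1"
  proof (rule Cauchy_inequality)
    show "G holomorphic_on ball z \<eta>"
      using near dG assms by (auto simp: holomorphic_on_open intro!: less_imp_le) (meson near less_imp_le mem_cball le_less_trans)
    show "continuous_on (cball z \<eta>) G"
      using near dG assms by (intro continuous_at_imp_continuous_on) (meson DERIV_isCont le_less_trans)
    show "norm (G w) \<le> B" if "norm (z - w) = \<eta>" for w
      using close near that by (simp add: G_def dist_norm)
  qed (use assms in auto)
  moreover have "deriv G z = poly (pderiv p) z - f z * F z"
    using DERIV_imp_deriv[OF dG] assms by simp
  ultimately have dG_bound: "norm (poly (pderiv p) z - f z * F z) \<le> B / \<eta>"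
    by simp
  have "norm (f z * G z) \<le> M * B"
    unfolding norm_mult G_def using assms order.trans[OF norm_ge_zero \<open>norm (f z) \<le> M\<close>]
    by (intro mult_mono close) auto
  with dG_bound have "norm ((poly (pderiv p) z - f z * F z) - f z * G z) \<le> B / \<eta> + M * B"
    by (rule order.trans[OF norm_triangle_ineq4 add_mono])
  moreover have "poly (pderiv p) z / poly p z - f z
      = ((poly (pderiv p) z - f z * F z) - f z * G z) / poly p z"
  proof -
    have "(poly (pderiv p) z - f z * F z) - f z * G z = poly (pderiv p) z - f z * poly p z"
      by (simp add: G_def algebra_simps)
    moreover have "poly p z \<noteq> 0"
      using assms by auto
    ultimately show ?thesis
      by (simp only: diff_divide_distrib[of _ "f z * poly p z"]) simp
  qed
  ultimately show ?thesis
    using assms by (simp add: norm_divide) (intro frac_le, auto intro: order.trans[OF norm_ge_zero])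
qed

theorem mainTheorem1:
  fixes f :: "complex \<Rightarrow> complex"
  assumes "f analytic_on ball 0 1"
    and "bounded (f ` ball 0 1)"
  shows "\<exists>(N0::nat) (P :: nat \<Rightarrow> complex poly).
           (\<forall>N\<ge>N0. C_polynomial (P N) \<and> degree (P N) = N) \<and>
           (\<forall>(a::real) (\<epsilon>::real). 0 < a \<and> a < 1 \<and> 0 < \<epsilon> \<and> \<epsilon> < 1 - a \<longrightarrow>
              (\<exists>\<delta> :: nat \<Rightarrow> real. \<delta> \<longlonglongrightarrow> 0 \<and>
                (\<forall>N\<ge>N0. \<forall>z\<in>cball 0 a.
                   norm (poly (pderiv (P N)) z / poly (P N) z - f z)
                     < (a + \<epsilon>) ^ (N div 2 + 1) / (\<epsilon> * (1 - a - \<epsilon>)) * (1 + \<delta> N))))"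
proof -
  have hol: "f holomorphic_on ball 0 1"
    using assms(1) by (rule analytic_imp_holomorphic)
  obtain M where M: "\<And>z. norm z < 1 \<Longrightarrow> norm (f z) \<le> M"
    using assms(2) unfolding bounded_iff by (metis dist_0_norm imageI mem_ball)
  obtain F where F: "\<And>z. norm z < 1 \<Longrightarrow> (F has_field_derivative f z * F z) (at z)"
    and F_lower: "\<And>z. norm z < 1 \<Longrightarrow> exp (- M) \<le> norm (F z)"
    and F_upper: "\<And>z. norm z < 1 \<Longrightarrow> norm (F z) \<le> exp M"
    using exponential_of_primitive[OF hol M] by blast
  have F_hol: "F holomorphic_on ball 0 1"
    using F by (auto simp: holomorphic_on_open intro!: exI)
  define c where "c k = (deriv ^^ k) F 0 / fact k" for k
  define A where "A = (\<Sum>k. norm (c k))"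
  have "norm (deriv F z) \<le> M * exp M" if "norm z < 1" for z
    unfolding DERIV_imp_deriv[OF F[OF that]] norm_mult
    using M[OF that] F_upper[OF that] order.trans[OF norm_ge_zero M[OF that]] by (intro mult_mono) auto
  then have summ: "summable (\<lambda>k. norm (c k))"
    unfolding c_def by (rule summable_norm_coeffs_of_bounded_deriv[OF F_hol])
  have sums: "(\<lambda>k. c k * z ^ k) sums F z" if "norm z < 1" for z
    using holomorphic_power_series[OF F_hol, of z] that by (simp add: c_def)
  obtain n0 where n0: "\<And>n z. n \<ge> n0 \<Longrightarrow> norm z \<le> 1 \<Longrightarrow> exp (- M) / 2 \<le> norm (poly (truncation c n) z)"
    using truncation_bounded_below[OF summ sums F_lower] by auto
  define S where "S N = truncation c (N div 2)" for N
  define m where "m N = N - degree (S N)" for N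
  define P where "P N = self_inversive_poly (m N) (S N)" for N
  \<comment> \<open>The summand 1 makes the shift \<open>m N\<close> positive, also when \<open>n0 = 0\<close>.\<close>
  define N0 where "N0 = 2 * n0 + 1"
  have N0: "degree (S N) \<le> N div 2" "m N \<ge> N div 2" "m N > 0" "m N + degree (S N) = N" "N div 2 \<ge> n0"
    if "N \<ge> N0" for N
    using degree_truncation_le[of c "N div 2"] that unfolding N0_def S_def m_def by linarith+
  have S_lower: "exp (- M) / 2 \<le> norm (poly (S N) z)" if "N \<ge> N0" "norm z \<le> 1" for N z
    unfolding S_def using n0 N0 that by blast
  have S_nz: "poly (S N) z \<noteq> 0" if "N \<ge> N0" "norm z \<le> 1" for N z
    using S_lower[OF that] exp_gt_zero[of "- M"] by (auto simp del: exp_gt_zero)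
  have "C_polynomial (P N) \<and> degree (P N) = N" if "N \<ge> N0" for N
    unfolding P_def using C_polynomial_self_inversive[OF S_nz[OF that]] degree_self_inversive[of "S N" "m N"]
      S_nz[OF that, of 0] N0[OF that] by simp
  moreover have "\<exists>\<delta> :: nat \<Rightarrow> real. \<delta> \<longlonglongrightarrow> 0 \<and>
                (\<forall>N\<ge>N0. \<forall>z\<in>cball 0 a.
                   norm (poly (pderiv (P N)) z / poly (P N) z - f z)
                     < (a + \<epsilon>) ^ (N div 2 + 1) / (\<epsilon> * (1 - a - \<epsilon>)) * (1 + \<delta> N))"
    if a: "0 < a" "a < 1" and \<epsilon>: "0 < \<epsilon>" "\<epsilon> < 1 - a" for a \<epsilon> :: real
  proof -
    \<comment> \<open>Half of \<open>\<epsilon>\<close> pays for Cauchy's inequality, and the other half for the constant factors.\<close>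
    define \<eta> where "\<eta> = \<epsilon> / 2"
    define r where "r = a + \<eta>"
    have r: "0 < \<eta>" "0 < r" "r < 1" "a + \<eta> < 1" "r < a + \<epsilon>"
      using a \<epsilon> by (auto simp: r_def \<eta>_def)
    define \<kappa> where "\<kappa> = (1 - a) * (exp (- M) / 2)"
    have "\<kappa> > 0" using a by (simp add: \<kappa>_def)
    define K where "K = (2 * A / \<eta> + M * (2 * A)) / \<kappa>"
    have A: "0 \<le> A" "(\<Sum>k. norm (c (k + Suc n))) \<le> A" for n
    proof -
      show "0 \<le> A"
        unfolding A_def by (intro suminf_nonneg summ) auto
      show "(\<Sum>k. norm (c (k + Suc n))) \<le> A"
        unfolding A_def suminf_split_initial_segment[OF summ, of "Suc n"]
        by (simp add: sum_nonneg del: sum.lessThan_Suc)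
    qed
    have error: "norm (poly (pderiv (P N)) z / poly (P N) z - f z) \<le> K * r ^ (N div 2)"
      if N: "N \<ge> N0" and z: "norm z \<le> a" for N z
    proof -
      define n where "n = N div 2"
      have close: "norm (poly (P N) w - F w) \<le> 2 * A * r ^ n" if w: "norm w \<le> a + \<eta>" for w
      proof -
        have w1: "norm w \<le> r" "norm w < 1" using w r by (auto simp: r_def)
        have "norm (poly (P N) w - poly (S N) w) \<le> norm w ^ m N * norm (poly (S N) w)"
          unfolding P_def using w1 S_nz[OF N] by (intro norm_self_inversive_minus_le) auto
        also have "\<dots> \<le> r ^ n * A"
        proof (intro mult_mono)
          have "norm w ^ m N \<le> norm w ^ n"
            using N0[OF N] w1 by (intro power_decreasing) (auto simp: n_def)
          also have "\<dots> \<le> r ^ n"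
            using w1 by (intro power_mono) auto
          finally show "norm w ^ m N \<le> r ^ n" .
          show "norm (poly (S N) w) \<le> A"
            unfolding S_def A_def using w1 by (intro norm_truncation_le summ) auto
        qed (use r in auto)
        finally have "norm (poly (P N) w - poly (S N) w) \<le> r ^ n * A" .
        moreover have "norm (F w - poly (S N) w) \<le> r ^ n * A"
        proof -
          have "norm (F w - poly (S N) w) \<le> norm w ^ n * (\<Sum>k. norm (c (k + Suc n)))"
            unfolding S_def n_def using w1 by (intro norm_minus_truncation_le summ sums) auto
          also have "\<dots> \<le> norm w ^ n * A"
            by (intro mult_left_mono A) auto
          also have "\<dots> \<le> r ^ n * A"
            using w1 A by (intro mult_right_mono power_mono) auto
          finally show ?thesis .
        qed
        ultimately show ?thesis
          using norm_triangle_ineq4[of "poly (P N) w - poly (S N) w" "F w - poly (S N) w"]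
          by (simp add: algebra_simps)
      qed
      have "\<kappa> \<le> norm (poly (P N) z)"
      proof -
        have "norm (poly (P N) z - poly (S N) z) \<le> norm z ^ m N * norm (poly (S N) z)"
          unfolding P_def using z a S_nz[OF N] by (intro norm_self_inversive_minus_le) auto
        also have "norm z ^ m N \<le> a"
          using power_decreasing[of 1 "m N" "norm z"] N0(3)[OF N] z a by simp
        finally have "norm (poly (P N) z - poly (S N) z) \<le> a * norm (poly (S N) z)"
          by (simp add: mult_right_mono)
        then have "(1 - a) * norm (poly (S N) z) \<le> norm (poly (P N) z)"
          using norm_triangle_ineq3[of "poly (P N) z" "poly (S N) z"] by (simp add: algebra_simps)
        moreover have "\<kappa> \<le> (1 - a) * norm (poly (S N) z)"
          unfolding \<kappa>_def using S_lower[OF N, of z] z a by (intro mult_left_mono) auto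
        ultimately show ?thesis by linarith
      qed
      then have "norm (poly (pderiv (P N)) z / poly (P N) z - f z)
          \<le> (2 * A * r ^ n / \<eta> + M * (2 * A * r ^ n)) / \<kappa>"
        using z a r M \<open>\<kappa> > 0\<close> by (intro log_derivative_error[OF F close]) auto
      also have "\<dots> = K * r ^ n"
        by (simp add: K_def field_simps)
      finally show ?thesis by (simp add: n_def)
    qed
    define B where "B N = (a + \<epsilon>) ^ (N div 2 + 1) / (\<epsilon> * (1 - a - \<epsilon>))" for N
    \<comment> \<open>Chosen so that \<open>B N * (1 + \<delta> N) = B N + K * r ^ (N div 2)\<close>; the summand \<open>B N > 0\<close>
      makes the inequality strict.\<close>
    define \<delta> where "\<delta> N = K * r ^ (N div 2) / B N" for N
    have B: "B N > 0" for N
      using a \<epsilon> by (simp add: B_def)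
    have "(\<lambda>n. (r / (a + \<epsilon>)) ^ n) \<longlonglongrightarrow> 0"
      using a \<epsilon> r by (intro LIMSEQ_power_zero) auto
    moreover have "filterlim (\<lambda>N::nat. N div 2) at_top sequentially"
      by (rule filterlim_at_top_div_const_nat) simp
    ultimately have "(\<lambda>N. (r / (a + \<epsilon>)) ^ (N div 2)) \<longlonglongrightarrow> 0"
      by (rule filterlim_compose)
    then have "(\<lambda>N. K * (\<epsilon> * (1 - a - \<epsilon>)) / (a + \<epsilon>) * (r / (a + \<epsilon>)) ^ (N div 2)) \<longlonglongrightarrow> 0"
      by (rule tendsto_mult_right_zero)
    moreover have "\<delta> = (\<lambda>N. K * (\<epsilon> * (1 - a - \<epsilon>)) / (a + \<epsilon>) * (r / (a + \<epsilon>)) ^ (N div 2))"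
      using a \<epsilon> by (simp add: \<delta>_def B_def power_divide fun_eq_iff)
    ultimately have "\<delta> \<longlonglongrightarrow> 0" by simp
    moreover have "norm (poly (pderiv (P N)) z / poly (P N) z - f z) < B N * (1 + \<delta> N)"
      if "N \<ge> N0" "z \<in> cball 0 a" for N z
    proof -
      have "B N * (1 + \<delta> N) = B N + K * r ^ (N div 2)"
        using B[of N] by (simp add: \<delta>_def distrib_left)
      then show ?thesis
        using error[of N z] that B[of N] by simp
    qed
    ultimately show ?thesis
      unfolding B_def by blast
  qed
  ultimately show ?thesis by blast
qed

end
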